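(* Let $\lambda>0$ and let $K,L\subset\mathbb{R}^n$ be non-empty compact sets. Then, as $L\to K$ under the Hausdorff distance, $M_\lambda(\cdot;L)\to M_\lambda(\cdot;K)$ uniformly on every fixed bounded set in $\mathbb{R}^n$. More precisely, if $\mu:=\mathrm{dist}_{\mathcal H}(K,L)$ is the Hausdorff distance between $K$ and $L$, then for every $x\in\mathbb{R}^n$, $$\big|C^l_\lambda(\mathrm{dist}^2(\cdot;K))(x)-C^l_\lambda(\mathrm{dist}^2(\cdot;L))(x)\big|\leq\mu\big((\mathrm{dist}(x;K)+\mu)^2+1+\mu\big)$$ and $$\big|M_\lambda(x;K)-M_\lambda(x;L)\big|\leq\mu(1+\lambda)\big((\mathrm{dist}(x;K)+\mu)^2+2\,\mathrm{dist}(x;K)+2\mu+1\big).$$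
   Context: $|\cdot|$ is the Euclidean norm on $\mathbb{R}^n$ and $\mathrm{dist}(x;E)=\inf\{|x-y|: y\in E\}$ for non-empty $E$. The Hausdorff distance is $\mathrm{dist}_{\mathcal H}(E,F)=\max\{\sup_{x\in E}\mathrm{dist}(x;F),\ \sup_{x\in F}\mathrm{dist}(x;E)\}$. For a continuous function $f:\mathbb{R}^n\to\mathbb{R}$ bounded below, $\mathrm{co}[f]$ denotes the convex envelope, i.e. the largest convex function not greater than $f$. For $\lambda>0$ the lower compensated convex transform is $C^l_\lambda(f)(x)=\mathrm{co}[f+\lambda|\cdot|^2](x)-\lambda|x|^2$. The quadratic multiscale medial axis map of a non-empty closed set $K$ with scale $\lambda>0$ is $M_\lambda(x;K)=(1+\lambda)\big(\mathrm{dist}^2(x;K)-C^l_\lambda(\mathrm{dist}^2(\cdot;K))(x)\big)$. *)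

theory Defs
  imports "HOL-Analysis.Analysis"
begin

text \<open>
  The distance of \<open>x\<close> to a non-empty set \<open>E\<close> is the library's \<^const>\<open>infdist\<close>.
  The suprema below are those of \<open>real\<close>, hence meaningful only for non-empty sets
  on which the distances are bounded, such as compact ones.
\<close>

definition hausdorff_dist :: "'a::metric_space set \<Rightarrow> 'a set \<Rightarrow> real" where
  "hausdorff_dist E F = max (SUP x\<in>E. infdist x F) (SUP x\<in>F. infdist x E)"

text \<open>
  The filter describing \<open>L \<rightarrow> K\<close> under the Hausdorff distance, where \<open>L\<close> ranges over
  the non-empty compact sets.
\<close>

definition hausdorff_nhds :: "'a::metric_space set \<Rightarrow> 'a set filter" where
  "hausdorff_nhds K =
     inf (filtercomap (hausdorff_dist K) (nhds 0)) (principal {L. compact L \<and> L \<noteq> {}})"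

text \<open>
  The greatest element is taken in the pointwise order on functions; it exists as soon as
  \<open>f\<close> has a convex minorant, in particular if \<open>f\<close> is bounded below (see the lemmas below).
\<close>

definition convex_envelope :: "('a::real_vector \<Rightarrow> real) \<Rightarrow> 'a \<Rightarrow> real" where
  "convex_envelope f = (GREATEST g. convex_on UNIV g \<and> g \<le> f)"

definition lower_compensated_transform ::
    "real \<Rightarrow> ('a::real_normed_vector \<Rightarrow> real) \<Rightarrow> 'a \<Rightarrow> real" where
  "lower_compensated_transform lam f x =
     convex_envelope (\<lambda>y. f y + lam * (norm y)\<^sup>2) x - lam * (norm x)\<^sup>2"

definition medial_axis_map :: "real \<Rightarrow> 'a::real_normed_vector set \<Rightarrow> 'a \<Rightarrow> real" where
  "medial_axis_map lam K x =
     (1 + lam) * ((infdist x K)\<^sup>2 - lower_compensated_transform lam (\<lambda>y. (infdist y K)\<^sup>2) x)"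

lemma hausdorff_dist_nonneg:
  assumes "compact E" "compact F" "E \<noteq> {}"
  shows "0 \<le> hausdorff_dist E F"
proof -
  obtain e where e: "e \<in> E" using assms by blast
  have "bdd_above ((\<lambda>x. infdist x F) ` E)"
    by (intro bounded_imp_bdd_above compact_imp_bounded compact_continuous_image
        continuous_intros assms)
  then have "infdist e F \<le> (SUP x\<in>E. infdist x F)"
    using e by (rule cSUP_upper2) simp
  then show ?thesis
    using infdist_nonneg[of e F] by (simp add: hausdorff_dist_def)
qed

lemma eventually_hausdorff_nhds:
  assumes "compact K" "K \<noteq> {}"
  shows "eventually P (hausdorff_nhds K) \<longleftrightarrow>
    (\<exists>d>0. \<forall>L. compact L \<longrightarrow> L \<noteq> {} \<longrightarrow> hausdorff_dist K L < d \<longrightarrow> P L)"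
    (is "?l \<longleftrightarrow> ?r")
proof
  assume ?l
  then obtain Q where Q: "eventually Q (nhds (0::real))"
    and QP: "\<And>L. Q (hausdorff_dist K L) \<Longrightarrow> compact L \<Longrightarrow> L \<noteq> {} \<Longrightarrow> P L"
    by (auto simp: hausdorff_nhds_def eventually_inf_principal eventually_filtercomap)
  obtain d where "d > 0" "\<And>y. dist y 0 < d \<Longrightarrow> Q y"
    using Q by (auto simp: eventually_nhds_metric)
  with QP hausdorff_dist_nonneg[OF assms(1) _ assms(2)] show ?r
    by (intro exI[of _ d]) auto
next
  assume ?r
  then obtain d where d: "d > 0"
    "\<And>L. compact L \<Longrightarrow> L \<noteq> {} \<Longrightarrow> hausdorff_dist K L < d \<Longrightarrow> P L"
    by blast
  have "eventually (\<lambda>y. y < d) (nhds (0::real))"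
    using d(1) by (intro eventually_nhds_in_open[where s="{..<d}", simplified])
  with d(2) show ?l
    by (auto simp: hausdorff_nhds_def eventually_inf_principal eventually_filtercomap)
qed

lemma convex_envelope_eqI:
  assumes "convex_on UNIV g" "g \<le> f" "\<And>h. convex_on UNIV h \<Longrightarrow> h \<le> f \<Longrightarrow> h \<le> g"
  shows "convex_envelope f = g"
  unfolding convex_envelope_def by (rule Greatest_equality) (use assms in auto)

lemma
  assumes "convex_on UNIV h0" "h0 \<le> f"
  shows convex_on_convex_envelope: "convex_on UNIV (convex_envelope f)"
    and convex_envelope_le: "convex_envelope f \<le> f"
    and convex_envelope_greatest:
      "\<And>h. convex_on UNIV h \<Longrightarrow> h \<le> f \<Longrightarrow> h \<le> convex_envelope f"
    and convex_envelope_eq_SUP: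
      "convex_envelope f x = (SUP h \<in> {h. convex_on UNIV h \<and> h \<le> f}. h x)"
proof -
  define S where "S = {h. convex_on UNIV h \<and> h \<le> f}"
  define g where "g = (\<lambda>x. SUP h\<in>S. h x)"
  have ne: "S \<noteq> {}" using assms by (auto simp: S_def)
  have bdd: "bdd_above ((\<lambda>h. h x) ` S)" for x
    by (rule bdd_aboveI[of _ "f x"]) (auto simp: S_def le_fun_def)
  have upper: "h x \<le> g x" if "h \<in> S" for h x
    unfolding g_def by (rule cSUP_upper[OF that bdd])
  have conv: "convex_on UNIV g"
    unfolding convex_on_def
  proof (intro conjI convex_UNIV ballI allI impI)
    fix x y and u v :: real
    assume uv: "0 \<le> u" "0 \<le> v" "u + v = 1"
    show "g (u *\<^sub>R x + v *\<^sub>R y) \<le> u * g x + v * g y"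
    proof (subst (1) g_def, rule cSUP_least[OF ne])
      fix h assume h: "h \<in> S"
      then have "h (u *\<^sub>R x + v *\<^sub>R y) \<le> u * h x + v * h y"
        using uv by (auto simp: S_def convex_on_def)
      also have "\<dots> \<le> u * g x + v * g y"
        by (intro add_mono mult_left_mono upper h uv)
      finally show "h (u *\<^sub>R x + v *\<^sub>R y) \<le> u * g x + v * g y" .
    qed
  qed
  have le: "g \<le> f"
    unfolding g_def le_fun_def
    by (intro allI cSUP_least[OF ne]) (auto simp: S_def le_fun_def)
  have great: "h \<le> g" if "convex_on UNIV h" "h \<le> f" for h
    using upper[of h] that by (auto simp: S_def le_fun_def)
  have eq: "convex_envelope f = g"
    by (rule convex_envelope_eqI[OF conv le great])
  show "convex_on UNIV (convex_envelope f)" "convex_envelope f \<le> f"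
    "\<And>h. convex_on UNIV h \<Longrightarrow> h \<le> f \<Longrightarrow> h \<le> convex_envelope f"
    using conv le great by (simp_all add: eq)
  show "convex_envelope f x = (SUP h \<in> {h. convex_on UNIV h \<and> h \<le> f}. h x)"
    by (simp add: eq g_def S_def)
qed

end

theory Submission
  imports Defs
begin

text \<open>
  If \<open>\<bar>dist(\<cdot>;K) - dist(\<cdot>;L)\<bar> \<le> \<mu>\<close>, then
  \<open>dist\<^sup>2(\<cdot>;L) \<le> (1 + \<mu>) dist\<^sup>2(\<cdot>;K) + \<mu> (1 + \<mu>)\<close>. Such a bound \<open>f \<le> c g + b\<close>
  with \<open>c \<ge> 1\<close> passes to the lower compensated transforms, because up to an affine function
  the quadratic weight at \<open>x\<close> is \<open>\<lambda> \<bar>\<cdot> - x\<bar>\<^sup>2 \<le> c \<lambda> \<bar>\<cdot> - x\<bar>\<^sup>2\<close>, and adding an affine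
  function commutes with taking the convex envelope. As the transform of
  \<open>dist\<^sup>2(\<cdot>;K)\<close> lies below \<open>dist\<^sup>2(\<cdot>;K)\<close>, the estimates follow by exchanging \<open>K\<close> and \<open>L\<close>.
\<close>

lemma hausdorff_dist_commute: "hausdorff_dist E F = hausdorff_dist F E"
  by (simp add: hausdorff_dist_def max.commute)

text \<open>Compactness of \<open>E\<close> keeps the distances bounded, so the real supremum is a
  genuine upper bound.\<close>

lemma infdist_le_hausdorff_dist:
  assumes "compact E" "e \<in> E"
  shows "infdist e F \<le> hausdorff_dist E F"
proof -
  have "bdd_above ((\<lambda>x. infdist x F) ` E)"
    by (intro bounded_imp_bdd_above compact_imp_bounded compact_continuous_image
        continuous_intros assms)
  then have "infdist e F \<le> (SUP x\<in>E. infdist x F)"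
    using assms(2) by (rule cSUP_upper2) simp
  then show ?thesis
    by (simp add: hausdorff_dist_def)
qed

text \<open>Triangle inequality through a point of \<open>E\<close> nearest to \<open>x\<close>.
  Used in both orders, it says that the two distance functions differ by at most the Hausdorff
  distance.\<close>

lemma infdist_le_infdist_add_hausdorff_dist:
  fixes E F :: "'a::heine_borel set"
  assumes "compact E" "E \<noteq> {}"
  shows "infdist x F \<le> infdist x E + hausdorff_dist E F"
proof -
  obtain e where e: "e \<in> E" "infdist x E = dist x e"
    using infdist_attains_inf[OF compact_imp_closed[OF assms(1)] assms(2)] by blast
  have "infdist x F \<le> infdist e F + dist x e"
    by (rule infdist_triangle)
  with infdist_le_hausdorff_dist[OF assms(1) e(1), of F] e(2) show ?thesis
    by simp
qed

text \<open>The constant \<open>m\<close> is a convex minorant of the perturbed function, so the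
  greatest convex minorant exists and the general facts about it apply.\<close>

lemma
  fixes f :: "'a::real_normed_vector \<Rightarrow> real"
  assumes "0 \<le> lam" "\<And>y. m \<le> f y"
  shows convex_on_envelope_quadratic: "convex_on UNIV (convex_envelope (\<lambda>y. f y + lam * (norm y)\<^sup>2))"
    and envelope_quadratic_le: "convex_envelope (\<lambda>y. f y + lam * (norm y)\<^sup>2) \<le> (\<lambda>y. f y + lam * (norm y)\<^sup>2)"
    and envelope_quadratic_greatest: "\<And>h. convex_on UNIV h \<Longrightarrow> h \<le> (\<lambda>y. f y + lam * (norm y)\<^sup>2)
      \<Longrightarrow> h \<le> convex_envelope (\<lambda>y. f y + lam * (norm y)\<^sup>2)"
proof -
  have c: "convex_on UNIV (\<lambda>y::'a. m)"
    by (simp add: convex_on_const)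
  have "m \<le> f y + lam * (norm y)\<^sup>2" for y
    using assms(2)[of y] mult_nonneg_nonneg[OF assms(1), of "(norm y)\<^sup>2"] by simp
  then have m: "(\<lambda>y. m) \<le> (\<lambda>y. f y + lam * (norm y)\<^sup>2)"
    by (simp add: le_fun_def)
  note * = convex_on_convex_envelope[OF c m] convex_envelope_le[OF c m]
    convex_envelope_greatest[OF c m]
  show "convex_on UNIV (convex_envelope (\<lambda>y. f y + lam * (norm y)\<^sup>2))"
    "convex_envelope (\<lambda>y. f y + lam * (norm y)\<^sup>2) \<le> (\<lambda>y. f y + lam * (norm y)\<^sup>2)"
    "\<And>h. convex_on UNIV h \<Longrightarrow> h \<le> (\<lambda>y. f y + lam * (norm y)\<^sup>2)
      \<Longrightarrow> h \<le> convex_envelope (\<lambda>y. f y + lam * (norm y)\<^sup>2)"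
    using * by blast+
qed

lemma lower_compensated_transform_le:
  fixes f :: "'a::real_normed_vector \<Rightarrow> real"
  assumes "0 \<le> lam" "\<And>y. m \<le> f y"
  shows "lower_compensated_transform lam f x \<le> f x"
  using envelope_quadratic_le[of lam m f, OF assms]
  by (simp add: lower_compensated_transform_def le_fun_def diff_le_eq)

lemma lower_compensated_transform_affine_bound:
  fixes f g :: "'a::real_inner \<Rightarrow> real"
  assumes lam: "0 \<le> lam" and m: "\<And>y. m \<le> f y" and c: "1 \<le> c"
    and fg: "\<And>y. f y \<le> c * g y + b"
  shows "lower_compensated_transform lam f x \<le> c * lower_compensated_transform lam g x + b"
proof -
  define F where "F = convex_envelope (\<lambda>y. f y + lam * (norm y)\<^sup>2)"
  define G where "G = convex_envelope (\<lambda>y. g y + lam * (norm y)\<^sup>2)"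
  have F: "convex_on UNIV F" "F y \<le> f y + lam * (norm y)\<^sup>2" for y
    using convex_on_envelope_quadratic[of lam m f, OF lam m]
      envelope_quadratic_le[of lam m f, OF lam m]
    by (auto simp: F_def le_fun_def)
  \<comment> \<open>\<open>g\<close> inherits a lower bound from \<open>f\<close>; this guarantees
    that the envelope \<open>G\<close> exists.\<close>
  have mg: "(m - b) / c \<le> g y" for y
  proof -
    have "m \<le> c * g y + b"
      using m[of y] fg[of y] by simp
    with c show ?thesis
      by (simp add: divide_le_eq algebra_simps)
  qed
  \<comment> \<open>The affine function that recentres the quadratic weight at \<open>x\<close>. Its
    value at \<open>x\<close> is \<open>lam * (norm x)\<^sup>2\<close>, exactly the term that the
    transform subtracts there.\<close>
  define a where "a y = lam * (2 * (x \<bullet> y) - (norm x)\<^sup>2)" for y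
  have a: "lam * (norm y)\<^sup>2 = lam * (norm (y - x))\<^sup>2 + a y" for y
    by (simp add: a_def power2_norm_eq_inner inner_diff_left inner_diff_right inner_commute
        algebra_simps)
  \<comment> \<open>A competitor for \<open>G\<close>: recentre \<open>F\<close>, solve the bound on
    \<open>f\<close> for \<open>g\<close>, and undo the recentring. Convexity survives since
    \<open>a\<close> is affine and \<open>c\<close> is positive; at \<open>x\<close>, the inequality
    \<open>h x \<le> G x\<close> is the claim divided by \<open>c\<close>.\<close>
  define h where "h y = (F y - a y - b) / c + a y" for y
  have "convex_on UNIV h"
  proof (rule convex_onI)
    fix t :: real and y z :: 'a
    assume t: "0 < t" "t < 1"
    define w where "w = (1 - t) *\<^sub>R y + t *\<^sub>R z"
    have Fw: "F w \<le> (1 - t) * F y + t * F z"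
      unfolding w_def using t by (intro convex_onD[OF F(1)]) auto
    have aw: "a w = (1 - t) * a y + t * a z"
      by (simp add: a_def w_def inner_add_right algebra_simps)
    have "F w - a w - b \<le> (1 - t) * (F y - a y - b) + t * (F z - a z - b)"
      using Fw aw by (simp add: algebra_simps)
    then have "(F w - a w - b) / c
        \<le> ((1 - t) * (F y - a y - b) + t * (F z - a z - b)) / c"
      using c by (intro divide_right_mono) auto
    also have "\<dots> = (1 - t) * ((F y - a y - b) / c) + t * ((F z - a z - b) / c)"
      by (simp add: add_divide_distrib)
    finally show "h w \<le> (1 - t) * h y + t * h z"
      unfolding h_def aw by (simp only: distrib_left)
  qed simp
  moreover have "h \<le> (\<lambda>y. g y + lam * (norm y)\<^sup>2)"
  proof (rule le_funI)
    fix y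
    \<comment> \<open>The recentred weight is nonnegative, so it may be enlarged by the factor
      \<open>c\<close>, which lets \<open>c\<close> be divided out of both terms.\<close>
    have "lam * (norm (y - x))\<^sup>2 \<le> c * (lam * (norm (y - x))\<^sup>2)"
      using mult_right_mono[OF c, of "lam * (norm (y - x))\<^sup>2"] lam by simp
    then have "F y - a y - b \<le> c * (g y + lam * (norm (y - x))\<^sup>2)"
      using F(2)[of y] fg[of y] a[of y] by (simp add: algebra_simps)
    then have "(F y - a y - b) / c \<le> g y + lam * (norm (y - x))\<^sup>2"
      using c by (simp add: divide_le_eq mult.commute)
    then show "h y \<le> g y + lam * (norm y)\<^sup>2"
      by (simp add: h_def a[of y])
  qed
  ultimately have "h \<le> G"
    unfolding G_def using envelope_quadratic_greatest[of lam _ g, OF lam mg] by blast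
  then have "h x \<le> G x"
    by (simp add: le_fun_def)
  then have "(F x - a x - b) / c \<le> G x - a x"
    by (simp add: h_def)
  then have "F x - a x - b \<le> c * (G x - a x)"
    using c by (simp add: divide_le_eq mult.commute)
  moreover have "a x = lam * (norm x)\<^sup>2"
    using a[of x] by simp
  ultimately show ?thesis
    by (simp add: lower_compensated_transform_def F_def G_def)
qed

lemma lower_compensated_transform_infdist_le:
  fixes E F :: "'a::{real_inner, heine_borel} set"
  assumes lam: "0 \<le> lam" and E: "compact E" "E \<noteq> {}" and F: "compact F" "F \<noteq> {}"
  defines "\<mu> \<equiv> hausdorff_dist E F"
  shows "lower_compensated_transform lam (\<lambda>y. (infdist y F)\<^sup>2) x
    \<le> lower_compensated_transform lam (\<lambda>y. (infdist y E)\<^sup>2) x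
      + \<mu> * ((infdist x E)\<^sup>2 + 1 + \<mu>)"
proof -
  have mu: "0 \<le> \<mu>"
    unfolding \<mu>_def by (rule hausdorff_dist_nonneg[OF E(1) F(1) E(2)])
  have "(infdist y F)\<^sup>2 \<le> (1 + \<mu>) * (infdist y E)\<^sup>2 + \<mu> * (1 + \<mu>)" for y
  proof -
    have "(infdist y F)\<^sup>2 \<le> (infdist y E + \<mu>)\<^sup>2"
      unfolding \<mu>_def using infdist_le_infdist_add_hausdorff_dist[OF E]
      by (intro power_mono) (auto simp: infdist_nonneg)
    \<comment> \<open>With d the distance to \<open>E\<close>, this absorbs the cross term of the
      square: 2 \<mu> d is at most \<mu> d^2 + \<mu>.\<close>
    moreover have "0 \<le> \<mu> * (infdist y E - 1)\<^sup>2"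
      using mu by simp
    ultimately show ?thesis
      by (simp add: power2_eq_square algebra_simps)
  qed
  then have "lower_compensated_transform lam (\<lambda>y. (infdist y F)\<^sup>2) x
      \<le> (1 + \<mu>) * lower_compensated_transform lam (\<lambda>y. (infdist y E)\<^sup>2) x + \<mu> * (1 + \<mu>)"
    using mu by (intro lower_compensated_transform_affine_bound[where m = 0] lam) auto
  \<comment> \<open>Turns the excess \<mu> in the factor 1 + \<mu> into an additive error.\<close>
  moreover have "\<mu> * lower_compensated_transform lam (\<lambda>y. (infdist y E)\<^sup>2) x
      \<le> \<mu> * (infdist x E)\<^sup>2"
    using mu lam by (intro mult_left_mono lower_compensated_transform_le[where m = 0]) auto
  ultimately show ?thesis
    by (simp add: algebra_simps)
qed

lemma lower_compensated_transform_infdist_bound: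
  fixes K L :: "'a::{real_inner, heine_borel} set"
  assumes lam: "0 \<le> lam" and K: "compact K" "K \<noteq> {}" and L: "compact L" "L \<noteq> {}"
  defines "\<mu> \<equiv> hausdorff_dist K L"
  shows "\<bar>lower_compensated_transform lam (\<lambda>y. (infdist y K)\<^sup>2) x
      - lower_compensated_transform lam (\<lambda>y. (infdist y L)\<^sup>2) x\<bar>
    \<le> \<mu> * ((infdist x K + \<mu>)\<^sup>2 + 1 + \<mu>)"
proof -
  have mu: "0 \<le> \<mu>"
    unfolding \<mu>_def by (rule hausdorff_dist_nonneg[OF K(1) L(1) K(2)])
  \<comment> \<open>The two one-sided estimates involve the distances to \<open>K\<close> and to
    \<open>L\<close>; both are at most \<open>infdist x K + \<mu>\<close>, which gives a common
    bound.\<close>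
  have "\<mu> * ((infdist x E)\<^sup>2 + 1 + \<mu>) \<le> \<mu> * ((infdist x K + \<mu>)\<^sup>2 + 1 + \<mu>)"
    if "infdist x E \<le> infdist x K + \<mu>" for E
    using that mu by (intro mult_left_mono add_right_mono power_mono) (auto simp: infdist_nonneg)
  from this[of K] this[of L] show ?thesis
    using lower_compensated_transform_infdist_le[OF lam K L, of x]
      lower_compensated_transform_infdist_le[OF lam L K, of x]
      infdist_le_infdist_add_hausdorff_dist[OF K, of x L] mu
    by (simp add: hausdorff_dist_commute[of L K] abs_le_iff flip: \<mu>_def)
qed

lemma medial_axis_map_bound:
  fixes K L :: "'a::{real_inner, heine_borel} set"
  assumes lam: "0 \<le> lam" and K: "compact K" "K \<noteq> {}" and L: "compact L" "L \<noteq> {}"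
  defines "\<mu> \<equiv> hausdorff_dist K L"
  shows "\<bar>medial_axis_map lam K x - medial_axis_map lam L x\<bar>
    \<le> \<mu> * (1 + lam) * ((infdist x K + \<mu>)\<^sup>2 + 2 * infdist x K + 2 * \<mu> + 1)"
proof -
  define D where "D = (infdist x K)\<^sup>2 - (infdist x L)\<^sup>2"
  define T where "T = lower_compensated_transform lam (\<lambda>y. (infdist y K)\<^sup>2) x
    - lower_compensated_transform lam (\<lambda>y. (infdist y L)\<^sup>2) x"
  have KL: "infdist x L \<le> infdist x K + \<mu>" "infdist x K \<le> infdist x L + \<mu>"
    using infdist_le_infdist_add_hausdorff_dist[OF K, of x L]
      infdist_le_infdist_add_hausdorff_dist[OF L, of x K]
    by (simp_all add: \<mu>_def hausdorff_dist_commute[of L K])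
  \<comment> \<open>Difference of squares: the first factor is at most \<mu>, and the second is at
    most twice the distance to \<open>K\<close> plus \<mu>.\<close>
  have "\<bar>D\<bar> = \<bar>infdist x K - infdist x L\<bar> * (infdist x K + infdist x L)"
    by (simp add: D_def power2_eq_square square_diff_square_factored abs_mult infdist_nonneg
        mult.commute)
  also have "\<dots> \<le> \<mu> * (2 * infdist x K + \<mu>)"
    using KL by (intro mult_mono) (auto simp: infdist_nonneg)
  finally have "\<bar>D - T\<bar> \<le> \<mu> * (2 * infdist x K + \<mu>) + \<mu> * ((infdist x K + \<mu>)\<^sup>2 + 1 + \<mu>)"
    using lower_compensated_transform_infdist_bound[OF lam K L, of x]
    unfolding T_def \<mu>_def by linarith
  then have "(1 + lam) * \<bar>D - T\<bar>
      \<le> (1 + lam) * (\<mu> * (2 * infdist x K + \<mu>) + \<mu> * ((infdist x K + \<mu>)\<^sup>2 + 1 + \<mu>))"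
    using lam by (intro mult_left_mono) auto
  moreover have "medial_axis_map lam K x - medial_axis_map lam L x = (1 + lam) * (D - T)"
    by (simp add: medial_axis_map_def D_def T_def algebra_simps)
  then have "\<bar>medial_axis_map lam K x - medial_axis_map lam L x\<bar> = (1 + lam) * \<bar>D - T\<bar>"
    using lam by (simp add: abs_mult)
  ultimately show ?thesis
    by (simp add: algebra_simps)
qed

lemma uniform_limit_medial_axis_map:
  fixes K :: "'a::{real_inner, heine_borel} set"
  assumes lam: "0 \<le> lam" and K: "compact K" "K \<noteq> {}" and B: "bounded B"
  shows "uniform_limit B (medial_axis_map lam) (medial_axis_map lam K) (hausdorff_nhds K)"
proof (rule uniform_limitI)
  fix e :: real
  assume e: "0 < e"
  \<comment> \<open>A ball about a point of \<open>K\<close> that contains \<open>B\<close> bounds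
    the distance to \<open>K\<close> by its radius, uniformly on \<open>B\<close>.\<close>
  obtain k where k: "k \<in> K"
    using K by blast
  obtain R where R: "0 < R" "B \<subseteq> ball k R"
    using bounded_subset_ballD[OF B] by blast
  \<comment> \<open>The factor beside \<mu> in the pointwise bound, with the distance replaced by
    \<open>R\<close> and \<mu> by 1.\<close>
  define C where "C = (1 + lam) * ((R + 1)\<^sup>2 + 2 * R + 3)"
  have C: "0 < C"
    unfolding C_def using lam R by (intro mult_pos_pos) (auto intro: add_nonneg_pos)
  \<comment> \<open>In the threshold, 1 justifies the replacement of \<mu> made in \<open>C\<close>,
    and \<open>e / C\<close> makes \<open>\<mu> * C\<close> smaller than \<open>e\<close>.\<close>
  have "dist (medial_axis_map lam L x) (medial_axis_map lam K x) < e"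
    if L: "compact L" "L \<noteq> {}" and d: "hausdorff_dist K L < min 1 (e / C)" and x: "x \<in> B" for L x
  proof -
    define \<mu> where "\<mu> = hausdorff_dist K L"
    have mu: "0 \<le> \<mu>" "\<mu> \<le> 1" "\<mu> * C < e"
      using hausdorff_dist_nonneg[OF K(1) L(1) K(2)] d C
      by (simp_all add: \<mu>_def pos_less_divide_eq)
    have xK: "infdist x K \<le> R"
      using infdist_le[OF k, of x] R(2) x by (force simp: dist_commute)
    have "\<bar>medial_axis_map lam K x - medial_axis_map lam L x\<bar>
        \<le> \<mu> * (1 + lam) * ((infdist x K + \<mu>)\<^sup>2 + 2 * infdist x K + 2 * \<mu> + 1)"
      unfolding \<mu>_def by (rule medial_axis_map_bound[OF lam K L])
    also have "\<dots> \<le> \<mu> * (1 + lam) * ((R + 1)\<^sup>2 + 2 * R + 2 * 1 + 1)"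
      using mu lam xK
      by (intro mult_left_mono add_mono power_mono mult_nonneg_nonneg) (auto simp: infdist_nonneg)
    also have "\<dots> = \<mu> * C"
      by (simp add: C_def)
    also note mu(3)
    finally show ?thesis
      by (simp add: dist_real_def abs_minus_commute)
  qed
  then show "\<forall>\<^sub>F L in hausdorff_nhds K. \<forall>x\<in>B.
      dist (medial_axis_map lam L x) (medial_axis_map lam K x) < e"
    unfolding eventually_hausdorff_nhds[OF K]
    using e C by (intro exI[of _ "min 1 (e / C)"]) auto
qed

theorem theorem4p3:
  fixes K :: "(real ^ 'n) set" and lam :: real
  assumes "lam > 0" and "compact K" and "K \<noteq> {}"
  shows "(\<forall>B. bounded B \<longrightarrow>
            uniform_limit B (\<lambda>L. medial_axis_map lam L) (medial_axis_map lam K) (hausdorff_nhds K)) \<and>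
         (\<forall>L \<mu>. compact L \<longrightarrow> L \<noteq> {} \<longrightarrow> \<mu> = hausdorff_dist K L \<longrightarrow>
            (\<forall>x. \<bar>lower_compensated_transform lam (\<lambda>y. (infdist y K)\<^sup>2) x
                   - lower_compensated_transform lam (\<lambda>y. (infdist y L)\<^sup>2) x\<bar>
                 \<le> \<mu> * ((infdist x K + \<mu>)\<^sup>2 + 1 + \<mu>) \<and>
                 \<bar>medial_axis_map lam K x - medial_axis_map lam L x\<bar>
                 \<le> \<mu> * (1 + lam) * ((infdist x K + \<mu>)\<^sup>2 + 2 * infdist x K + 2 * \<mu> + 1)))"
proof (intro conjI allI impI)
  have lam: "0 \<le> lam"
    using assms(1) by simp
  show "uniform_limit B (\<lambda>L. medial_axis_map lam L) (medial_axis_map lam K) (hausdorff_nhds K)"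
    if "bounded B" for B
    by (rule uniform_limit_medial_axis_map[OF lam assms(2,3) that])
  fix L :: "(real ^ 'n) set" and \<mu> x
  assume L: "compact L" "L \<noteq> {}" and mu: "\<mu> = hausdorff_dist K L"
  show "\<bar>lower_compensated_transform lam (\<lambda>y. (infdist y K)\<^sup>2) x
        - lower_compensated_transform lam (\<lambda>y. (infdist y L)\<^sup>2) x\<bar>
      \<le> \<mu> * ((infdist x K + \<mu>)\<^sup>2 + 1 + \<mu>)"
    unfolding mu by (rule lower_compensated_transform_infdist_bound[OF lam assms(2,3) L])
  show "\<bar>medial_axis_map lam K x - medial_axis_map lam L x\<bar>
      \<le> \<mu> * (1 + lam) * ((infdist x K + \<mu>)\<^sup>2 + 2 * infdist x K + 2 * \<mu> + 1)"
    unfolding mu by (rule medial_axis_map_bound[OF lam assms(2,3) L])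
qed

end
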